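(* For the decorated hypercubic lattice model described in the context (any $d\ge1$), in the subspace with electron number $N_{\rm e}=L^d$ the ground states of $H$ all have total spin $S_{\rm tot}=N_{\rm e}/2$, and the ground state space has dimension exactly $2S_{\rm tot}+1=N_{\rm e}+1$ (i.e. the ground state is unique apart from the $(2S_{\rm tot}+1)$-fold spin degeneracy).
   Context: Let $d\ge1$ and let $L\ge4$ be an even integer. Let $V=(\mathbb Z/L\mathbb Z)^d$ be the $d$-dimensional $L\times\cdots\times L$ hypercubic lattice with periodic boundary conditions, and let $B$ be the set of nearest-neighbour bonds $\{v,w\}$ ($v,w\in V$ at (periodic) Euclidean distance $1$). For each bond $\{v,w\}\in B$ introduce a new site $m(v,w)$ (the midpoint of the bond); let $M$ be the set of these midpoints and $\Lambda=V\cup M$. With fermion operators $c_{x\sigma}$, $x\in\Lambda$, $\sigma\in\{\uparrow,\downarrow\}$, satisfying the canonical anticommutation relations, vacuum $\Phi_0$, $n_{x\sigma}=c^\dagger_{x\sigma}c_{x\sigma}$ and electron number operator $\hat N_{\rm e}=\sum_x(n_{x\uparrow}+n_{x\downarrow})$, the Hamiltonian is $H=H_{\rm hop}+H_{\rm int}$ with $$H_{\rm hop}=\sum_{\sigma}\sum_{\{v,w\}\in B}t\,(c^\dagger_{v\sigma}+c^\dagger_{w\sigma}+\lambda c^\dagger_{m(v,w)\sigma})(c_{v\sigma}+c_{w\sigma}+\lambda c_{m(v,w)\sigma}),$$ $$H_{\rm int}=U\sum_{u\in V}n_{u\uparrow}n_{u\downarrow}+U'\sum_{x\in M}n_{x\uparrow}n_{x\downarrow},$$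 where $t>0$, $\lambda>0$, $U>0$, $U'>0$. Spin operators: $S^{(\alpha)}_x=\frac12\sum_{\sigma,\tau}c^\dagger_{x\sigma}p^{(\alpha)}_{\sigma\tau}c_{x\tau}$ with $p^{(1)},p^{(2)},p^{(3)}$ the Pauli matrices; $S^{(\alpha)}_{\rm tot}=\sum_{x\in\Lambda}S^{(\alpha)}_x$ and $({\bf S}_{\rm tot})^2=\sum_{\alpha=1}^3(S^{(\alpha)}_{\rm tot})^2$, whose eigenvalues are written $S_{\rm tot}(S_{\rm tot}+1)$. *)

theory Defs
  imports Complex_Main "HOL-Library.Countable" "HOL-Library.List_Lexorder" "HOL-Library.Function_Algebras"
begin

definition verts :: "nat \<Rightarrow> nat \<Rightarrow> nat list set" where
  "verts d L = {v. length v = d \<and> (\<forall>i<d. v ! i < L)}"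

text \<open>Periodic Euclidean distance 1 on the torus: the two points differ in exactly one
  coordinate, and there by +1 or -1 modulo L.\<close>
definition step :: "nat \<Rightarrow> nat \<Rightarrow> nat list \<Rightarrow> nat list \<Rightarrow> bool" where
  "step d L v w \<longleftrightarrow> (\<exists>i<d. w ! i = (v ! i + 1) mod L \<and> (\<forall>j<d. j \<noteq> i \<longrightarrow> w ! j = v ! j))"

definition adjacent :: "nat \<Rightarrow> nat \<Rightarrow> nat list \<Rightarrow> nat list \<Rightarrow> bool" where
  "adjacent d L v w \<longleftrightarrow> v \<in> verts d L \<and> w \<in> verts d L \<and> (step d L v w \<or> step d L w v)"

definition bonds :: "nat \<Rightarrow> nat \<Rightarrow> nat list set set" where
  "bonds d L = {{v, w} | v w. adjacent d L v w}"

datatype site = Vtx "nat list" | Mid "nat list" "nat list"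

instance site :: countable by countable_datatype

definition midpt :: "nat list \<Rightarrow> nat list \<Rightarrow> site" where
  "midpt v w = Mid (min v w) (max v w)"

definition bond_mid :: "nat list set \<Rightarrow> site" where
  "bond_mid b = midpt (Min b) (Max b)"

definition mids :: "nat \<Rightarrow> nat \<Rightarrow> site set" where
  "mids d L = bond_mid ` bonds d L"

definition sites :: "nat \<Rightarrow> nat \<Rightarrow> site set" where
  "sites d L = Vtx ` verts d L \<union> mids d L"

text \<open>A mode is (site, spin), spin True = up, False = down. A state is a coefficient function
  on occupation sets (finite sets of modes); the basis vector for S is
  c^dag_{m1} ... c^dag_{mk} Phi_0 with m1 < ... < mk in the order given by to_nat.\<close>
type_synonym mode = "site \<times> bool"
type_synonym state = "mode set \<Rightarrow> complex"

definition modes :: "nat \<Rightarrow> nat \<Rightarrow> mode set" where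
  "modes d L = sites d L \<times> UNIV"

definition fsign :: "mode \<Rightarrow> mode set \<Rightarrow> complex" where
  "fsign m T = (-1) ^ card {m' \<in> T. to_nat m' < to_nat m}"

definition cr :: "mode \<Rightarrow> state \<Rightarrow> state" where
  "cr m \<psi> = (\<lambda>S. if m \<in> S then fsign m (S - {m}) * \<psi> (S - {m}) else 0)"

definition an :: "mode \<Rightarrow> state \<Rightarrow> state" where
  "an m \<psi> = (\<lambda>S. if m \<notin> S then fsign m S * \<psi> (insert m S) else 0)"

definition vacuum :: state where
  "vacuum = (\<lambda>S. if S = {} then 1 else 0)"

definition sc :: "complex \<Rightarrow> state \<Rightarrow> state" where
  "sc c \<psi> = (\<lambda>S. c * \<psi> S)"

definition addst :: "state \<Rightarrow> state \<Rightarrow> state" where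
  "addst \<phi> \<psi> = (\<lambda>S. \<phi> S + \<psi> S)"

definition opsum :: "'i set \<Rightarrow> ('i \<Rightarrow> state) \<Rightarrow> state" where
  "opsum A F = (\<lambda>S. \<Sum>a\<in>A. F a S)"

definition fock :: "nat \<Rightarrow> nat \<Rightarrow> state set" where
  "fock d L = {\<psi>. \<forall>S. \<psi> S \<noteq> 0 \<longrightarrow> S \<subseteq> modes d L}"

definition numop :: "mode \<Rightarrow> state \<Rightarrow> state" where
  "numop m \<psi> = cr m (an m \<psi>)"

definition Nop :: "nat \<Rightarrow> nat \<Rightarrow> state \<Rightarrow> state" where
  "Nop d L \<psi> = opsum (modes d L) (\<lambda>m. numop m \<psi>)"

definition bond_an :: "real \<Rightarrow> nat list set \<Rightarrow> bool \<Rightarrow> state \<Rightarrow> state" where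
  "bond_an lam b \<sigma> \<psi> = addst (addst (an (Vtx (Min b), \<sigma>) \<psi>) (an (Vtx (Max b), \<sigma>) \<psi>))
                          (sc (of_real lam) (an (bond_mid b, \<sigma>) \<psi>))"

definition bond_cr :: "real \<Rightarrow> nat list set \<Rightarrow> bool \<Rightarrow> state \<Rightarrow> state" where
  "bond_cr lam b \<sigma> \<psi> = addst (addst (cr (Vtx (Min b), \<sigma>) \<psi>) (cr (Vtx (Max b), \<sigma>) \<psi>))
                          (sc (of_real lam) (cr (bond_mid b, \<sigma>) \<psi>))"

definition Hhop :: "nat \<Rightarrow> nat \<Rightarrow> real \<Rightarrow> real \<Rightarrow> state \<Rightarrow> state" where
  "Hhop d L t lam \<psi> = opsum (UNIV :: bool set) (\<lambda>\<sigma>. opsum (bonds d L)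
      (\<lambda>b. sc (of_real t) (bond_cr lam b \<sigma> (bond_an lam b \<sigma> \<psi>))))"

definition Hint :: "nat \<Rightarrow> nat \<Rightarrow> real \<Rightarrow> real \<Rightarrow> state \<Rightarrow> state" where
  "Hint d L U U' \<psi> = addst
      (sc (of_real U) (opsum (Vtx ` verts d L) (\<lambda>x. numop (x, True) (numop (x, False) \<psi>))))
      (sc (of_real U') (opsum (mids d L) (\<lambda>x. numop (x, True) (numop (x, False) \<psi>))))"

definition Ham :: "nat \<Rightarrow> nat \<Rightarrow> real \<Rightarrow> real \<Rightarrow> real \<Rightarrow> real \<Rightarrow> state \<Rightarrow> state" where
  "Ham d L t lam U U' \<psi> = addst (Hhop d L t lam \<psi>) (Hint d L U U' \<psi>)"

text \<open>Pauli matrices, index True = up (first row/column).\<close>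
definition pauli :: "nat \<Rightarrow> bool \<Rightarrow> bool \<Rightarrow> complex" where
  "pauli \<alpha> \<sigma> \<tau> =
     (if \<alpha> = 1 then (if \<sigma> \<noteq> \<tau> then 1 else 0)
      else if \<alpha> = 2 then (if \<sigma> = \<tau> then 0 else if \<sigma> then - \<i> else \<i>)
      else (if \<sigma> = \<tau> then (if \<sigma> then 1 else -1) else 0))"

definition spin_site :: "nat \<Rightarrow> site \<Rightarrow> state \<Rightarrow> state" where
  "spin_site \<alpha> x \<psi> = sc (1/2) (opsum (UNIV :: (bool \<times> bool) set)
      (\<lambda>(\<sigma>, \<tau>). sc (pauli \<alpha> \<sigma> \<tau>) (cr (x, \<sigma>) (an (x, \<tau>) \<psi>))))"

definition spin_tot :: "nat \<Rightarrow> nat \<Rightarrow> nat \<Rightarrow> state \<Rightarrow> state" where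
  "spin_tot d L \<alpha> \<psi> = opsum (sites d L) (\<lambda>x. spin_site \<alpha> x \<psi>)"

definition spin_sq :: "nat \<Rightarrow> nat \<Rightarrow> state \<Rightarrow> state" where
  "spin_sq d L \<psi> = opsum {1, 2, 3} (\<lambda>\<alpha>. spin_tot d L \<alpha> (spin_tot d L \<alpha> \<psi>))"

definition sector :: "nat \<Rightarrow> nat \<Rightarrow> nat \<Rightarrow> state set" where
  "sector d L N = {\<psi> \<in> fock d L. Nop d L \<psi> = sc (of_nat N) \<psi>}"

definition energies :: "nat \<Rightarrow> nat \<Rightarrow> real \<Rightarrow> real \<Rightarrow> real \<Rightarrow> real \<Rightarrow> nat \<Rightarrow> real set" where
  "energies d L t lam U U' N =
     {E. \<exists>\<psi> \<in> sector d L N. \<psi> \<noteq> (\<lambda>_. 0) \<and> Ham d L t lam U U' \<psi> = sc (of_real E) \<psi>}"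

definition ground_energy :: "nat \<Rightarrow> nat \<Rightarrow> real \<Rightarrow> real \<Rightarrow> real \<Rightarrow> real \<Rightarrow> nat \<Rightarrow> real" where
  "ground_energy d L t lam U U' N = Min (energies d L t lam U U' N)"

definition ground_space :: "nat \<Rightarrow> nat \<Rightarrow> real \<Rightarrow> real \<Rightarrow> real \<Rightarrow> real \<Rightarrow> nat \<Rightarrow> state set" where
  "ground_space d L t lam U U' N =
     {\<psi> \<in> sector d L N. Ham d L t lam U U' \<psi> = sc (of_real (ground_energy d L t lam U U' N)) \<psi>}"

definition cdim :: "state set \<Rightarrow> nat" where
  "cdim A = vector_space.dim (\<lambda>(c::complex) (\<psi>::state) S. c * \<psi> S) A"

end

theory Submission
  imports Defs "HOL-Combinatorics.Transposition"
begin

text \<open>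
  The Hamiltonian is a sum of positive operators, so a state has energy \<open>0\<close> iff every bond operator
  annihilates it and no site is doubly occupied. Filling each localized zero-energy orbital once,
  with all spins in the first coordinate direction, gives such a state \<open>G\<close>.

  Conversely, the bond conditions express the amplitudes of a zero-energy state with electrons on
  midpoints through those with electrons on vertices only; with \<open>L ^ d\<close> electrons and no double
  occupancy the latter are spin configurations on the vertices. The absence of double occupancy on
  the midpoint of a bond makes the ratio to \<open>G\<close> invariant under exchanging neighbouring spins, so
  by connectedness the ratio depends only on the number of down spins. Hence the ground states are
  exactly the states \<open>f (downs S) * G S\<close>. Since \<open>an (x, True) G = an (x, False) G\<close>,
  the spin operators act on such states through \<open>f\<close> alone, in the representation of spin \<open>L ^ d / 2\<close>.
\<close>

section \<open>Canonical anticommutation relations\<close>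

text \<open>Injectivity of \<open>to_nat\<close> gives finiteness whatever the occupation set is, so
  the sign rules below need no finiteness hypothesis.\<close>

lemma finite_modes_below: "finite {m'::mode. to_nat m' < to_nat (m::mode) \<and> P m'}"
proof -
  have "finite (to_nat -` {..<to_nat m} :: mode set)"
    by (rule finite_vimageI) auto
  then show ?thesis by (rule rev_finite_subset) auto
qed

lemma fsign_insert:
  assumes "a \<notin> T"
  shows "fsign m (insert a T) = (if to_nat a < to_nat m then -1 else 1) * fsign m T"
proof (cases "to_nat a < to_nat m")
  case True
  have "{m' \<in> insert a T. to_nat m' < to_nat m} = insert a {m' \<in> T. to_nat m' < to_nat m}"
    using True by auto
  moreover have "finite {m' \<in> T. to_nat m' < to_nat m}"
    using finite_modes_below[of m "\<lambda>x. x \<in> T"] by (rule rev_finite_subset) auto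
  ultimately show ?thesis using True assms by (simp add: fsign_def)
next
  case False
  then have "{m' \<in> insert a T. to_nat m' < to_nat m} = {m' \<in> T. to_nat m' < to_nat m}"
    by auto
  then show ?thesis using False by (simp add: fsign_def)
qed

lemma fsign_nonzero [simp]: "fsign m T \<noteq> 0"
  by (simp add: fsign_def)

lemma fsign_mult_self [simp]: "fsign m T * fsign m T = 1" "fsign m T * (fsign m T * z) = z"
proof -
  show *: "fsign m T * fsign m T = 1"
    by (simp add: fsign_def flip: power_add mult_2)
  show "fsign m T * (fsign m T * z) = z"
    by (simp add: * flip: mult.assoc)
qed

lemma cnj_fsign [simp]: "cnj (fsign m T) = fsign m T"
  by (simp add: fsign_def)

lemma an_an_self [simp]: "an m (an m \<psi>) S = 0"
  by (simp add: an_def)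

text \<open>Of two distinct empty modes exactly one precedes the other, so exactly one of the two
  orders of annihilation picks up an extra sign.\<close>

lemma an_an_anticommute: "an m (an m' \<psi>) S = - an m' (an m \<psi>) S"
proof (cases "m = m' \<or> m \<in> S \<or> m' \<in> S")
  case True then show ?thesis by (auto simp: an_def)
next
  case False
  then have "to_nat m \<noteq> to_nat m'" by simp
  then show ?thesis using False
    by (auto simp: an_def fsign_insert insert_commute)
qed

lemma an_cr_anticommute:
  "an m (cr m' \<psi>) S = (if m = m' then \<psi> S else 0) - cr m' (an m \<psi>) S"
proof (cases "m = m'")
  case True
  then show ?thesis by (auto simp: an_def cr_def insert_absorb)
next
  case False
  then have n: "to_nat m \<noteq> to_nat m'" by simp
  show ?thesis
  \<comment> \<open>For distinct modes both sides vanish unless \<open>m\<close> is empty and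
    \<open>m'\<close> is occupied in \<open>S\<close>.\<close>
  proof (cases "m \<notin> S \<and> m' \<in> S")
    case True
    define T where "T = S - {m'}"
    then have T: "S = insert m' T" "m \<notin> T" "m' \<notin> T" using True by auto
    have "insert m (insert m' T) - {m'} = insert m T" using T False by auto
    then show ?thesis using T False n
      by (simp add: an_def cr_def fsign_insert)
  next
    case F: False
    then show ?thesis using False by (auto simp: an_def cr_def)
  qed
qed

lemma numop_apply: "numop m \<psi> S = (if m \<in> S then \<psi> S else 0)"
  by (auto simp: numop_def an_def cr_def insert_absorb)

lemma an_lincomb:
  "an m (\<lambda>S. \<Sum>x\<in>X. c x * F x S) S = (\<Sum>x\<in>X. c x * an m (F x) S)"
  by (auto simp: an_def sum_distrib_left algebra_simps)

lemma an_add: "an m (\<lambda>S. f S + g S) S = an m f S + an m g S"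
  and an_diff: "an m (\<lambda>S. f S - g S) S = an m f S - an m g S"
  and an_scale: "an m (\<lambda>S. c * f S) S = c * an m f S"
  by (auto simp: an_def algebra_simps)

lemma bond_an_apply:
  "bond_an lam b \<sigma> \<psi> S =
     an (Vtx (Min b), \<sigma>) \<psi> S + an (Vtx (Max b), \<sigma>) \<psi> S + of_real lam * an (bond_mid b, \<sigma>) \<psi> S"
  by (simp add: bond_an_def addst_def sc_def)

section \<open>The decorated lattice\<close>

lemma finite_verts [simp]: "finite (verts d L)" and card_verts: "card (verts d L) = L ^ d"
proof -
  have *: "verts d L = {xs. set xs \<subseteq> {..<L} \<and> length xs = d}"
    by (auto simp: verts_def in_set_conv_nth subset_iff)
  show "finite (verts d L)" unfolding * by (rule finite_lists_length_eq) simp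
  show "card (verts d L) = L ^ d" unfolding * by (subst card_lists_length_eq) auto
qed

text \<open>A loop would require 1 = 0 modulo \<open>L\<close>.\<close>

lemma step_not_refl:
  assumes "L \<ge> 2" "v \<in> verts d L"
  shows "\<not> step d L v v"
proof
  assume "step d L v v"
  then obtain i where i: "i < d" "v ! i = (v ! i + 1) mod L" by (auto simp: step_def)
  moreover have "v ! i < L" using i assms by (auto simp: verts_def)
  ultimately show False using assms(1) by (cases "v ! i + 1 = L") auto
qed

text \<open>The lexicographic order picks canonical end points of an unordered bond, which is how
  bond operators and midpoints are indexed.\<close>

lemma bondsE:
  assumes "b \<in> bonds d L" "L \<ge> 2"
  obtains "Min b \<in> verts d L" "Max b \<in> verts d L" "Min b \<noteq> Max b" "b = {Min b, Max b}"
    "bond_mid b = Mid (Min b) (Max b)"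
proof -
  obtain v w where b: "b = {v, w}" "adjacent d L v w"
    using assms(1) by (auto simp: bonds_def)
  then have "v \<noteq> w" using step_not_refl assms(2) by (auto simp: adjacent_def)
  moreover have "Min b \<in> b" "Max b \<in> b" "Min b \<le> Max b" using b by (auto simp: min_def max_def)
  moreover have "b = {Min b, Max b}" using b by (auto simp: min_def max_def)
  ultimately show ?thesis
    using b by (intro that) (auto simp: adjacent_def bond_mid_def midpt_def min_absorb1 max_absorb2)
qed

lemma finite_bonds [simp]: "finite (bonds d L)"
proof -
  have "bonds d L \<subseteq> Pow (verts d L)" by (auto simp: bonds_def adjacent_def)
  then show ?thesis by (rule finite_subset) simp
qed

lemma finite_sites [simp]: "finite (sites d L)"
  by (simp add: sites_def mids_def)

lemma finite_modes [simp]: "finite (modes d L)"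
  by (simp add: modes_def)

lemma bond_sites:
  assumes "b \<in> bonds d L" "L \<ge> 2"
  shows "Vtx (Min b) \<in> sites d L" "Vtx (Max b) \<in> sites d L" "bond_mid b \<in> sites d L"
  using assms by (auto elim!: bondsE simp: sites_def mids_def)

section \<open>Connectedness of the torus and exchange invariance\<close>

lemma torus_connected:
  assumes "\<And>v w. adjacent d L v w \<Longrightarrow> R v w"
    and refl: "\<And>v. R v v" and trans: "\<And>u v w. R u v \<Longrightarrow> R v w \<Longrightarrow> R u w"
    and sym: "\<And>v w. R v w \<Longrightarrow> R w v"
    and v: "v \<in> verts d L" and w: "w \<in> verts d L"
  shows "R v w"
proof -
  \<comment> \<open>Every vertex is linked to the origin by lowering a positive coordinate; no step
    of this descent wraps around.\<close>
  have "R v (replicate d 0)" if "v \<in> verts d L" for v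
    using that
  proof (induction "sum_list v" arbitrary: v rule: less_induct)
    case less
    show ?case
    proof (cases "\<exists>i<d. v ! i > 0")
      case False
      then have "v = replicate d 0"
        using less.prems by (auto simp: verts_def intro!: nth_equalityI)
      then show ?thesis using refl by simp
    next
      case True
      then obtain i where i: "i < d" "v ! i > 0" by auto
      define u where "u = v[i := v ! i - 1]"
      have len: "length v = d" and lt: "\<And>j. j < d \<Longrightarrow> v ! j < L"
        using less.prems by (auto simp: verts_def)
      have u: "u \<in> verts d L"
        using i len lt by (auto simp: verts_def u_def nth_list_update less_imp_diff_less)
      have "step d L u v"
        unfolding step_def using i len lt by (intro exI[of _ i]) (auto simp: u_def nth_list_update)
      then have "adjacent d L v u" using u less.prems by (simp add: adjacent_def)
      moreover have "sum_list u < sum_list v"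
        using i len elem_le_sum_list[of i v] by (simp add: u_def sum_list_update)
      ultimately show ?thesis using less.hyps u assms(1) trans by blast
    qed
  qed
  then show ?thesis using v w sym trans by blast
qed

text \<open>Transpositions along edges of a connected graph generate all transpositions, because
  \<open>(u w) = (u v)(v w)(u v)\<close>.\<close>

lemma adjacent_swap_invariant_imp_card_invariant:
  assumes swap: "\<And>v w A. adjacent d L v w \<Longrightarrow> A \<subseteq> verts d L \<Longrightarrow> v \<in> A \<Longrightarrow> w \<notin> A \<Longrightarrow>
      h (insert w (A - {v})) = h A"
    and AB: "A \<subseteq> verts d L" "B \<subseteq> verts d L" "card A = card B"
  shows "h A = h B"
proof -
  define V where "V = verts d L"
  define inv where "inv = (\<lambda>v w. v \<in> V \<and> w \<in> V \<and> (\<forall>A\<subseteq>V. h (transpose v w ` A) = h A))"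
  have transp_img: "transpose v w ` A = (if v \<in> A \<longleftrightarrow> w \<in> A then A
       else if v \<in> A then insert w (A - {v}) else insert v (A - {w}))" for v w :: "nat list" and A
    by (auto simp: transpose_def image_iff split: if_splits)
  have inv_sym: "inv w v" if "inv v w" for v w
    using that unfolding inv_def by (auto simp: transpose_commute)
  have inv_trans: "inv u w" if "inv u v" "inv v w" "u \<noteq> v" "v \<noteq> w" "u \<noteq> w" for u v w
    unfolding inv_def
  proof (intro conjI allI impI)
    show "u \<in> V" "w \<in> V" using that by (auto simp: inv_def)
    fix A assume A: "A \<subseteq> V"
    have sub: "transpose x y ` C \<subseteq> V" if "x \<in> V" "y \<in> V" "C \<subseteq> V" for x y C
      using that by (auto simp: transpose_def)
    have "transpose u w = transpose u v \<circ> transpose v w \<circ> transpose u v"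
      using that by (subst transpose_comp_triple) auto
    then have "transpose u w ` A = transpose u v ` transpose v w ` transpose u v ` A"
      by (simp add: image_comp)
    then show "h (transpose u w ` A) = h A"
      using that A sub by (simp add: inv_def)
  qed
  have inv_adj: "inv v w" if vw: "adjacent d L v w" for v w
    unfolding inv_def
  proof (intro conjI allI impI)
    show "v \<in> V" "w \<in> V" using vw by (auto simp: adjacent_def V_def)
    have wv: "adjacent d L w v" using vw by (auto simp: adjacent_def)
    fix A assume "A \<subseteq> V"
    then show "h (transpose v w ` A) = h A"
      using swap[OF vw] swap[OF wv] by (simp add: transp_img V_def)
  qed
  \<comment> \<open>Equality is added to \<open>inv\<close> because \<open>torus_connected\<close>
    wants reflexivity at all lists, while \<open>inv v v\<close> holds only for vertices, and
    because \<open>inv_trans\<close> covers distinct points only.\<close>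
  have inv: "v = w \<or> inv v w" if "v \<in> V" "w \<in> V" for v w
    by (rule torus_connected[where R = "\<lambda>v w. v = w \<or> inv v w"])
      (use that inv_adj inv_sym inv_trans in \<open>unfold V_def, blast+\<close>)
  \<comment> \<open>Trading a point of \<open>A - B\<close> for one of \<open>B - A\<close> brings
    \<open>A\<close> closer to \<open>B\<close> and keeps its cardinality.\<close>
  have "h A = h B" if "A \<subseteq> V" "B \<subseteq> V" "card A = card B" for A
    using that
  proof (induction "card (A - B)" arbitrary: A rule: less_induct)
    case less
    have fin: "finite A" "finite B" using less.prems by (auto simp: V_def intro: finite_subset)
    show ?case
    proof (cases "A = B")
      case False
      have "\<not> A \<subseteq> B" "\<not> B \<subseteq> A"
        using False fin less.prems(3) card_subset_eq by metis+
      then obtain v w where vw: "v \<in> A" "v \<notin> B" "w \<in> B" "w \<notin> A" by auto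
      then have "inv v w" using inv less.prems by blast
      then have "h A = h (insert w (A - {v}))"
        using less.prems vw by (auto simp: inv_def transp_img)
      also have "\<dots> = h B"
      proof (rule less.hyps)
        have "insert w (A - {v}) - B = (A - B) - {v}" using vw by auto
        then show "card (insert w (A - {v}) - B) < card (A - B)"
          using vw fin card_Diff1_less[of "A - B" v] by simp
        show "insert w (A - {v}) \<subseteq> V" "B \<subseteq> V" using less.prems vw by auto
        have "card A > 0" using vw fin by (auto simp: card_gt_0_iff)
        then show "card (insert w (A - {v})) = card B"
          using vw fin less.prems by simp
      qed
      finally show ?thesis .
    qed simp
  qed
  then show ?thesis using AB unfolding V_def by blast
qed

section \<open>Frustration-free states\<close>

text \<open>These clauses together characterise zero energy in the sector of \<open>L ^ d\<close>
  electrons; see \<open>zero_energy_iff_frustration_free\<close>.\<close>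

definition frustration_free :: "nat \<Rightarrow> nat \<Rightarrow> real \<Rightarrow> state \<Rightarrow> bool" where
  "frustration_free d L lam \<psi> \<longleftrightarrow>
     (\<forall>b\<in>bonds d L. \<forall>\<sigma> S. bond_an lam b \<sigma> \<psi> S = 0) \<and>
     (\<forall>x\<in>sites d L. \<forall>S. (x, True) \<in> S \<and> (x, False) \<in> S \<longrightarrow> \<psi> S = 0) \<and>
     (\<forall>S. \<psi> S \<noteq> 0 \<longrightarrow> S \<subseteq> modes d L \<and> card S = L ^ d)"

text \<open>The localized zero-energy orbital around the vertex \<open>v\<close>; the orbitals \<open>orbital lam v\<close>
  span the kernel of the hopping matrix.\<close>

definition orbital :: "real \<Rightarrow> nat list \<Rightarrow> mode \<Rightarrow> complex" where
  "orbital lam v m = (case fst m of Vtx u \<Rightarrow> if u = v then 1 else 0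
     | Mid a b \<Rightarrow> if v = a \<or> v = b then - 1 / of_real lam else 0)"

text \<open>The amplitude ignores the spin, so both spins enter with equal weight: up to
  normalisation, an electron with spin along the first axis.\<close>

definition orbital_cr :: "nat \<Rightarrow> nat \<Rightarrow> real \<Rightarrow> nat list \<Rightarrow> state \<Rightarrow> state" where
  "orbital_cr d L lam v \<psi> = (\<lambda>S. \<Sum>m\<in>modes d L. orbital lam v m * cr m \<psi> S)"

text \<open>All spins point in the first coordinate direction.\<close>

primrec polarized :: "nat \<Rightarrow> nat \<Rightarrow> real \<Rightarrow> nat list list \<Rightarrow> state" where
  "polarized d L lam [] = vacuum"
| "polarized d L lam (v # vs) = orbital_cr d L lam v (polarized d L lam vs)"

section \<open>The polarized product state\<close>

lemma an_orbital_cr: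
  assumes "m \<in> modes d L"
  shows "an m (orbital_cr d L lam v \<psi>) S = orbital lam v m * \<psi> S - orbital_cr d L lam v (an m \<psi>) S"
proof -
  have "an m (orbital_cr d L lam v \<psi>) S = (\<Sum>x\<in>modes d L. orbital lam v x * an m (cr x \<psi>) S)"
    by (simp add: orbital_cr_def an_lincomb)
  also have "\<dots> = (\<Sum>x\<in>modes d L. (if m = x then orbital lam v x * \<psi> S else 0)
                        - orbital lam v x * cr x (an m \<psi>) S)"
    by (intro sum.cong) (auto simp: an_cr_anticommute algebra_simps)
  also have "\<dots> = orbital lam v m * \<psi> S - orbital_cr d L lam v (an m \<psi>) S"
    using assms by (simp add: sum_subtractf orbital_cr_def)
  finally show ?thesis .
qed

lemma orbital_cr_bond_an:
  "orbital_cr d L lam v (bond_an lam b \<sigma> \<psi>) S =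
     orbital_cr d L lam v (an (Vtx (Min b), \<sigma>) \<psi>) S + orbital_cr d L lam v (an (Vtx (Max b), \<sigma>) \<psi>) S
     + of_real lam * orbital_cr d L lam v (an (bond_mid b, \<sigma>) \<psi>) S"
proof -
  have "cr m (bond_an lam b \<sigma> \<psi>) S = cr m (an (Vtx (Min b), \<sigma>) \<psi>) S + cr m (an (Vtx (Max b), \<sigma>) \<psi>) S
     + of_real lam * cr m (an (bond_mid b, \<sigma>) \<psi>) S" for m
    by (simp add: cr_def bond_an_apply algebra_simps)
  then show ?thesis
    by (simp add: orbital_cr_def sum_distrib_left sum.distrib algebra_simps)
qed

lemma orbital_cr_zero: "orbital_cr d L lam v (\<lambda>S. 0) S = 0"
  unfolding orbital_cr_def by (rule sum.neutral) (auto simp: cr_def)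

text \<open>The anticommutator is the scalar obtained by evaluating the bond form on the orbital,
  and this scalar is zero.\<close>

lemma bond_an_orbital_cr:
  assumes "b \<in> bonds d L" "L \<ge> 2" "lam \<noteq> 0"
  shows "bond_an lam b \<sigma> (orbital_cr d L lam v \<psi>) S = - orbital_cr d L lam v (bond_an lam b \<sigma> \<psi>) S"
proof -
  have "(Vtx (Min b), \<sigma>) \<in> modes d L" "(Vtx (Max b), \<sigma>) \<in> modes d L" "(bond_mid b, \<sigma>) \<in> modes d L"
    using bond_sites[OF assms(1,2)] by (auto simp: modes_def)
  \<comment> \<open>If \<open>v\<close> is an end of the bond, \<open>lam\<close> times the midpoint
    amplitude \<open>- 1 / lam\<close> cancels the 1 at \<open>v\<close>; otherwise all three
    amplitudes vanish.\<close>
  moreover have "orbital lam v (Vtx (Min b), \<sigma>) + orbital lam v (Vtx (Max b), \<sigma>)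
      + of_real lam * orbital lam v (bond_mid b, \<sigma>) = 0"
    by (rule bondsE[OF assms(1,2)]) (use assms(3) in \<open>auto simp: orbital_def\<close>)
  then have "orbital lam v (Vtx (Min b), \<sigma>) * \<psi> S + orbital lam v (Vtx (Max b), \<sigma>) * \<psi> S
      + of_real lam * (orbital lam v (bond_mid b, \<sigma>) * \<psi> S) = 0"
    by (metis distrib_right mult.assoc mult_zero_left)
  ultimately show ?thesis
    by (simp add: bond_an_apply an_orbital_cr orbital_cr_bond_an algebra_simps)
qed

lemma bond_an_polarized:
  assumes "b \<in> bonds d L" "L \<ge> 2" "lam \<noteq> 0"
  shows "bond_an lam b \<sigma> (polarized d L lam vs) = (\<lambda>S. 0)"
proof (induction vs)
  case Nil
  then show ?case by (auto simp: bond_an_apply an_def vacuum_def)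
next
  case (Cons v vs)
  then show ?case using assms by (auto simp: bond_an_orbital_cr orbital_cr_zero)
qed

text \<open>The difference of the two annihilators anticommutes with every
  \<open>orbital_cr\<close>, whose amplitudes do not see the spin, and it kills the vacuum.\<close>

lemma an_polarized_spin_independent:
  assumes "x \<in> sites d L"
  shows "an (x, \<sigma>) (polarized d L lam vs) = an (x, \<tau>) (polarized d L lam vs)"
proof (induction vs)
  case Nil
  then show ?case by (auto simp: an_def vacuum_def)
next
  case (Cons v vs)
  have "orbital lam v (x, \<sigma>) = orbital lam v (x, \<tau>)" by (simp add: orbital_def)
  then show ?case using assms Cons by (auto simp: an_orbital_cr modes_def)
qed

lemma polarized_support:
  "polarized d L lam vs S \<noteq> 0 \<Longrightarrow> S \<subseteq> modes d L \<and> card S = length vs"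
proof (induction vs arbitrary: S)
  case Nil
  then show ?case by (auto simp: vacuum_def split: if_splits)
next
  case (Cons v vs)
  then obtain m where m: "m \<in> modes d L" "cr m (polarized d L lam vs) S \<noteq> 0"
    by (auto simp: orbital_cr_def elim: sum.not_neutral_contains_not_neutral)
  then have mS: "m \<in> S" and *: "S - {m} \<subseteq> modes d L" "card (S - {m}) = length vs"
    using Cons.IH[of "S - {m}"] by (auto simp: cr_def split: if_splits)
  moreover have "finite (S - {m})" using * finite_subset finite_modes by blast
  then have "finite S" by simp
  then have "card S > 0" using mS by (auto simp: card_gt_0_iff)
  ultimately show ?case using m by auto
qed

text \<open>Among vertices each orbital lives on its own centre only. With all electrons on vertices
  there is thus a single way to fill the orbitals, and the amplitude is a product of signs.\<close>

lemma polarized_nonzero: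
  assumes "distinct vs" "set vs \<subseteq> verts d L"
  shows "polarized d L lam vs ((\<lambda>v. (Vtx v, s v)) ` set vs) \<noteq> 0"
  using assms
proof (induction vs)
  case Nil
  then show ?case by (simp add: vacuum_def)
next
  case (Cons v vs)
  let ?S = "(\<lambda>v. (Vtx v, s v)) ` set (v # vs)" and ?P = "polarized d L lam vs"
  let ?m = "(Vtx v, s v)"
  have "polarized d L lam (v # vs) ?S = (\<Sum>m\<in>modes d L. if m = ?m then cr ?m ?P ?S else 0)"
    unfolding polarized.simps orbital_cr_def
    by (intro sum.cong refl) (auto simp: orbital_def cr_def split: if_splits)
  moreover have "?m \<in> modes d L" using Cons.prems by (simp add: modes_def sites_def)
  ultimately have "polarized d L lam (v # vs) ?S = cr ?m ?P ?S" by simp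
  also have "\<dots> = fsign ?m (?S - {?m}) * ?P (?S - {?m})"
    by (simp add: cr_def)
  also have "?S - {?m} = (\<lambda>v. (Vtx v, s v)) ` set vs"
    using Cons.prems by auto
  finally show ?case using Cons by simp
qed

section \<open>Reference states and functions of the number of down spins\<close>

definition config :: "nat \<Rightarrow> nat \<Rightarrow> nat list set \<Rightarrow> mode set" where
  "config d L A = (\<lambda>v. (Vtx v, v \<in> A)) ` verts d L"

definition downs :: "mode set \<Rightarrow> nat" where
  "downs S = card {m \<in> S. \<not> snd m}"

text \<open>The square of \<open>an (x, False)\<close> is zero; the hypothesis lets one factor flip
  its spin, which turns Pauli exclusion into absence of double occupancy.\<close>

lemma no_double_occupancy_of_spin_symmetric:
  assumes "an (x, True) G = an (x, False) G" "(x, True) \<in> S" "(x, False) \<in> S"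
  shows "G S = 0"
proof -
  define T where "T = S - {(x, True), (x, False)}"
  have S: "S = insert (x, True) (insert (x, False) T)" "(x, True) \<notin> T" "(x, False) \<notin> T"
    using assms by (auto simp: T_def)
  have "0 = an (x, False) (an (x, False) G) T" by simp
  also have "\<dots> = an (x, False) (an (x, True) G) T" by (simp add: assms(1))
  also have "\<dots> = fsign (x, False) T * (fsign (x, True) (insert (x, False) T) * G S)"
    using S by (simp add: an_def)
  finally show ?thesis by simp
qed

lemma downs_insert:
  assumes "finite S" "m \<notin> S"
  shows "downs (insert m S) = downs S + (if snd m then 0 else 1)"
proof -
  have "{m' \<in> insert m S. \<not> snd m'} = (if snd m then {} else {m}) \<union> {m' \<in> S. \<not> snd m'}" by auto
  then show ?thesis using assms by (auto simp: downs_def)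
qed

text \<open>This isolates what later arguments use of the polarized state: \<open>spin_G\<close>
  controls double occupancy and the spin operators, \<open>config_G\<close> permits division by
  \<open>G\<close>.\<close>

locale reference_state =
  fixes d L :: nat and lam :: real and G :: state
  assumes L: "L \<ge> 2" and lam: "lam \<noteq> 0"
    and bond_G: "b \<in> bonds d L \<Longrightarrow> bond_an lam b \<sigma> G S = 0"
    and spin_G: "x \<in> sites d L \<Longrightarrow> an (x, \<sigma>) G = an (x, \<tau>) G"
    and supp_G: "G S \<noteq> 0 \<Longrightarrow> S \<subseteq> modes d L \<and> card S = L ^ d"
    and config_G: "G (config d L A) \<noteq> 0"

lemma reference_state_exists:
  assumes "L \<ge> 2" "lam \<noteq> 0"
  obtains G where "reference_state d L lam G"
proof -
  obtain vs where vs: "set vs = verts d L" "distinct vs"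
    using finite_distinct_list[OF finite_verts] by blast
  then have "length vs = L ^ d" by (metis card_verts distinct_card)
  then have "reference_state d L lam (polarized d L lam vs)"
    using assms polarized_support[of d L lam vs] polarized_nonzero[OF vs(2), of d L lam] vs
      an_polarized_spin_independent
    by unfold_locales (auto simp: bond_an_polarized config_def)
  then show ?thesis by (rule that)
qed

context reference_state
begin

lemma frustration_free_G: "frustration_free d L lam G"
  unfolding frustration_free_def
  using bond_G supp_G no_double_occupancy_of_spin_symmetric[OF spin_G] by blast

text \<open>The spin of the annihilated electron fixes the shift in the number of down spins, so
  \<open>f\<close> comes out as a scalar.\<close>

lemma an_downs:
  assumes "finite S"
  shows "an m (\<lambda>S. f (downs S) * G S) S = f (downs S + (if snd m then 0 else 1)) * an m G S"
  using assms by (auto simp: an_def downs_insert)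

lemma supp_G': "\<not> S \<subseteq> modes d L \<Longrightarrow> G S = 0" "card S \<noteq> L ^ d \<Longrightarrow> G S = 0"
  using supp_G by blast+

text \<open>A bond operator involves one spin only, so its three terms share the same factor from
  \<open>f\<close>.\<close>

lemma frustration_free_downs: "frustration_free d L lam (\<lambda>S. f (downs S) * G S)"
  unfolding frustration_free_def
proof (intro conjI allI ballI impI)
  fix b \<sigma> S assume b: "b \<in> bonds d L"
  show "bond_an lam b \<sigma> (\<lambda>S. f (downs S) * G S) S = 0"
  proof (cases "finite S")
    case True
    have "bond_an lam b \<sigma> (\<lambda>S. f (downs S) * G S) S
        = f (downs S + (if \<sigma> then 0 else 1)) * bond_an lam b \<sigma> G S"
      by (simp only: bond_an_apply an_downs[OF True] snd_conv) (simp add: algebra_simps)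
    then show ?thesis using bond_G b by simp
  next
    case False
    then have "G (insert m S) = 0" for m
      using supp_G' finite_subset[OF _ finite_modes] by (metis finite_insert)
    then show ?thesis by (simp add: bond_an_apply an_def)
  qed
next
  fix x S assume "x \<in> sites d L" "(x, True) \<in> S \<and> (x, False) \<in> S"
  then show "f (downs S) * G S = 0"
    using frustration_free_G by (auto simp: frustration_free_def)
next
  fix S assume "f (downs S) * G S \<noteq> 0"
  then show "S \<subseteq> modes d L" "card S = L ^ d" using supp_G by auto
qed

end

section \<open>Exchange symmetry and elimination of midpoints\<close>

lemma frustration_free_bond:
  assumes "frustration_free d L lam \<psi>" "b \<in> bonds d L"
  shows "of_real lam * an (bond_mid b, \<sigma>) \<psi> S =
     - (an (Vtx (Min b), \<sigma>) \<psi> S + an (Vtx (Max b), \<sigma>) \<psi> S)"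
proof -
  have "bond_an lam b \<sigma> \<psi> S = 0" using assms by (auto simp: frustration_free_def)
  then show ?thesis by (simp add: bond_an_apply add_eq_0_iff)
qed

lemma frustration_free_an_an:
  assumes "frustration_free d L lam \<psi>" "x \<in> sites d L"
  shows "an (x, \<sigma>) (an (x, \<tau>) \<psi>) S = 0"
proof (cases "\<sigma> = \<tau>")
  case False
  then have "\<psi> (insert (x, \<tau>) (insert (x, \<sigma>) S)) = 0"
    using assms unfolding frustration_free_def by (cases \<sigma>; cases \<tau>) auto
  then show ?thesis by (cases \<sigma>; cases \<tau>) (auto simp: an_def)
qed simp

lemma frustration_free_diff:
  assumes "frustration_free d L lam \<phi>" "frustration_free d L lam \<psi>"
  shows "frustration_free d L lam (\<lambda>S. \<phi> S - \<psi> S)"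
proof -
  have "bond_an lam b \<sigma> (\<lambda>S. \<phi> S - \<psi> S) S = bond_an lam b \<sigma> \<phi> S - bond_an lam b \<sigma> \<psi> S" for b \<sigma> S
    by (simp add: bond_an_apply an_diff algebra_simps)
  then show ?thesis using assms unfolding frustration_free_def
    by (simp, metis diff_zero)
qed

text \<open>Absence of double occupancy on the midpoint of a bond becomes, after both midpoint
  operators are eliminated by the hopping condition, an exchange symmetry of the two vertices.\<close>

lemma frustration_free_exchange_bond:
  assumes ff: "frustration_free d L lam \<psi>" and b: "b \<in> bonds d L" and L: "L \<ge> 2"
  shows "an (Vtx (Min b), True) (an (Vtx (Max b), False) \<psi>) S
       + an (Vtx (Max b), True) (an (Vtx (Min b), False) \<psi>) S = 0"
proof -
  define v w m l where "v = Vtx (Min b)" and "w = Vtx (Max b)" and "m = bond_mid b"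
    and "l = complex_of_real lam"
  note defs = v_def [symmetric] w_def [symmetric] m_def [symmetric] l_def [symmetric]
  note sites = bond_sites[OF b L, unfolded defs]
  have mid: "(\<lambda>S. l * an (m, \<sigma>) \<psi> S) = (\<lambda>S. (-1) * (an (v, \<sigma>) \<psi> S + an (w, \<sigma>) \<psi> S))" for \<sigma>
    using frustration_free_bond[OF ff b] unfolding defs by auto
  have aux: "l * an y (an (m, \<sigma>) \<psi>) S = - (an y (an (v, \<sigma>) \<psi>) S + an y (an (w, \<sigma>) \<psi>) S)" for y \<sigma>
  proof -
    have "l * an y (an (m, \<sigma>) \<psi>) S = an y (\<lambda>S. l * an (m, \<sigma>) \<psi> S) S"
      by (simp only: an_scale)
    also have "\<dots> = - (an y (an (v, \<sigma>) \<psi>) S + an y (an (w, \<sigma>) \<psi>) S)"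
      by (simp only: mid an_scale an_add) simp
    finally show ?thesis .
  qed
  \<comment> \<open>One midpoint annihilator is replaced by vertex annihilators, then the other is
    anticommuted to the front position for the same replacement.\<close>
  have "0 = l * (l * an (m, True) (an (m, False) \<psi>) S)"
    using frustration_free_an_an[OF ff] sites by simp
  also have "\<dots> = l * - (an (m, True) (an (v, False) \<psi>) S + an (m, True) (an (w, False) \<psi>) S)"
    by (simp only: aux)
  also have "\<dots> = l * an (v, False) (an (m, True) \<psi>) S + l * an (w, False) (an (m, True) \<psi>) S"
    using an_an_anticommute[of "(m, True)" "(v, False)" \<psi> S]
      an_an_anticommute[of "(m, True)" "(w, False)" \<psi> S] by (simp add: algebra_simps)
  \<comment> \<open>The two terms with both annihilators on one vertex vanish by absence of double
    occupancy there.\<close>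
  also have "\<dots> = - (an (v, False) (an (w, True) \<psi>) S) - an (w, False) (an (v, True) \<psi>) S"
    unfolding aux using frustration_free_an_an[OF ff] sites by simp
  also have "\<dots> = an (w, True) (an (v, False) \<psi>) S + an (v, True) (an (w, False) \<psi>) S"
    by (subst (1 2) an_an_anticommute) simp
  finally show ?thesis by (simp add: defs add.commute)
qed

lemma frustration_free_exchange:
  assumes ff: "frustration_free d L lam \<psi>" and vw: "adjacent d L v w" and L: "L \<ge> 2"
  shows "an (Vtx v, True) (an (Vtx w, False) \<psi>) S + an (Vtx w, True) (an (Vtx v, False) \<psi>) S = 0"
proof -
  have b: "{v, w} \<in> bonds d L" using vw by (auto simp: bonds_def)
  show ?thesis
    using frustration_free_exchange_bond[OF ff b L, of S] by (auto simp: min_def max_def add.commute split: if_splits)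
qed

text \<open>Induction on the number of electrons on midpoints: the bond condition moves one of them
  to the ends of its bond. Without any, a pigeonhole argument places exactly one electron on each
  vertex.\<close>

lemma frustration_free_eq_0:
  assumes ff: "frustration_free d L lam \<chi>" and L: "L \<ge> 2" and lam: "lam \<noteq> 0"
    and cfg: "\<And>A. A \<subseteq> verts d L \<Longrightarrow> \<chi> (config d L A) = 0"
  shows "\<chi> S = 0"
proof (rule ccontr)
  assume "\<chi> S \<noteq> 0"
  then show False
  proof (induction "card {m \<in> S. fst m \<in> mids d L}" arbitrary: S rule: less_induct)
    case less
    have S: "S \<subseteq> modes d L" "card S = L ^ d"
      and nd: "\<And>x. x \<in> sites d L \<Longrightarrow> \<not> ((x, True) \<in> S \<and> (x, False) \<in> S)"
      using ff less.prems by (auto simp: frustration_free_def)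
    have fin: "finite S" using S finite_subset finite_modes by blast
    show False
    proof (cases "\<exists>m\<in>S. fst m \<in> mids d L")
      case True
      then obtain b \<sigma> where b: "b \<in> bonds d L" and bS: "(bond_mid b, \<sigma>) \<in> S"
        by (auto simp: mids_def)
      \<comment> \<open>The bond condition is evaluated at \<open>T\<close>, where it relates
        \<open>\<chi> S\<close> to the two amplitudes with the midpoint electron moved to an
        end.\<close>
      define T where "T = S - {(bond_mid b, \<sigma>)}"
      have T: "S = insert (bond_mid b, \<sigma>) T" "(bond_mid b, \<sigma>) \<notin> T" using bS by (auto simp: T_def)
      have bm: "bond_mid b \<in> mids d L" using b by (auto simp: mids_def)
      have vtx: "\<chi> (insert (Vtx v, \<sigma>) T) = 0" for v
      proof (rule ccontr)
        assume *: "\<chi> (insert (Vtx v, \<sigma>) T) \<noteq> 0"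
        have nm: "Vtx v \<notin> mids d L" by (auto simp: mids_def bond_mid_def midpt_def)
        have "{m \<in> insert (Vtx v, \<sigma>) T. fst m \<in> mids d L} \<subset> {m \<in> S. fst m \<in> mids d L}"
        proof (rule psubsetI)
          show "{m \<in> insert (Vtx v, \<sigma>) T. fst m \<in> mids d L} \<subseteq> {m \<in> S. fst m \<in> mids d L}"
            using nm by (auto simp: T_def)
          have "(bond_mid b, \<sigma>) \<notin> {m \<in> insert (Vtx v, \<sigma>) T. fst m \<in> mids d L}"
            using nm bm by (auto simp: T_def)
          then show "{m \<in> insert (Vtx v, \<sigma>) T. fst m \<in> mids d L} \<noteq> {m \<in> S. fst m \<in> mids d L}"
            using bS bm by (metis (mono_tags, lifting) fst_conv mem_Collect_eq)
        qed
        then have "card {m \<in> insert (Vtx v, \<sigma>) T. fst m \<in> mids d L} < card {m \<in> S. fst m \<in> mids d L}"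
          using fin by (intro psubset_card_mono) auto
        from less.hyps[OF this *] show False .
      qed
      have "of_real lam * (fsign (bond_mid b, \<sigma>) T * \<chi> S) = 0"
        using frustration_free_bond[OF ff b, of \<sigma> T] T vtx by (simp add: an_def)
      then show False using less.prems lam by simp
    next
      case False
      define A where "A = {v \<in> verts d L. (Vtx v, True) \<in> S}"
      have sub: "fst ` S \<subseteq> Vtx ` verts d L"
        using False S unfolding modes_def sites_def by force
      have "inj_on fst S"
      proof (rule inj_onI)
        fix m m' assume mm: "m \<in> S" "m' \<in> S" "fst m = fst m'"
        have "fst m \<in> sites d L" using mm S by (auto simp: modes_def)
        then show "m = m'" using nd mm by (cases m; cases m') (auto, (metis (full_types))+)
      qed
      \<comment> \<open>The number of electrons equals the number of vertices, so the injective map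
        \<open>fst\<close> on \<open>S\<close> hits every vertex.\<close>
      then have "card (fst ` S) = card (Vtx ` verts d L)"
        using S by (simp add: card_image card_verts inj_on_def)
      then have img: "fst ` S = Vtx ` verts d L"
        using sub by (intro card_subset_eq) auto
      have "S = config d L A"
      proof (intro set_eqI iffI)
        fix m assume m: "m \<in> S"
        then have "fst m \<in> Vtx ` verts d L" using sub by blast
        then obtain v \<sigma> where v: "m = (Vtx v, \<sigma>)" "v \<in> verts d L"
          by (metis imageE prod.collapse)
        have "\<sigma> = (v \<in> A)" using nd[of "Vtx v"] m v by (cases \<sigma>) (auto simp: A_def sites_def)
        then show "m \<in> config d L A" using v by (auto simp: config_def)
      next
        fix m assume "m \<in> config d L A"
        then obtain v where v: "m = (Vtx v, v \<in> A)" "v \<in> verts d L" by (auto simp: config_def)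
        then have "Vtx v \<in> fst ` S" unfolding img by blast
        then obtain \<sigma> where s: "(Vtx v, \<sigma>) \<in> S" by (metis imageE prod.collapse)
        then show "m \<in> S" using v nd[of "Vtx v"] by (cases \<sigma>) (auto simp: A_def sites_def)
      qed
      then show False using cfg[of A] less.prems by (auto simp: A_def)
    qed
  qed
qed

lemma downs_config:
  assumes "A \<subseteq> verts d L"
  shows "downs (config d L A) = L ^ d - card A"
proof -
  have "{m \<in> config d L A. \<not> snd m} = (\<lambda>v. (Vtx v, False)) ` (verts d L - A)"
    by (auto simp: config_def)
  then have "downs (config d L A) = card (verts d L - A)"
    by (simp add: downs_def card_image inj_on_def)
  also have "\<dots> = L ^ d - card A"
    using assms by (simp add: card_Diff_subset finite_subset[OF assms] card_verts)
  finally show ?thesis .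
qed

section \<open>Uniqueness up to functions of the number of down spins\<close>

context reference_state
begin

text \<open>The exchange relation is \<open>p * \<phi> A + q * \<phi> B = 0\<close> with signs
  \<open>p\<close>, \<open>q\<close> common to all frustration-free \<open>\<phi>\<close>; comparing
  \<open>\<psi>\<close> with \<open>G\<close> makes the signs cancel.\<close>

lemma config_exchange:
  assumes ff: "frustration_free d L lam \<psi>" and vw: "adjacent d L v w"
    and A: "v \<in> A" "w \<notin> A"
  defines "B \<equiv> insert w (A - {v})"
  shows "\<psi> (config d L B) / G (config d L B) = \<psi> (config d L A) / G (config d L A)"
proof -
  define T where "T = (\<lambda>v. (Vtx v, v \<in> A)) ` (verts d L - {v, w})"
  have V: "v \<in> verts d L" "w \<in> verts d L" using vw by (auto simp: adjacent_def)
  have n: "v \<noteq> w" using A by auto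
  have cA: "config d L A = insert (Vtx w, False) (insert (Vtx v, True) T)"
    using V A by (auto simp: config_def T_def image_iff)
  have cB: "config d L B = insert (Vtx v, False) (insert (Vtx w, True) T)"
    using V A n by (auto simp: config_def T_def B_def image_iff)
  have T: "(Vtx v, s) \<notin> T" "(Vtx w, s) \<notin> T" for s by (auto simp: T_def)
  define p where "p = fsign (Vtx v, True) T * fsign (Vtx w, False) (insert (Vtx v, True) T)"
  define q where "q = fsign (Vtx w, True) T * fsign (Vtx v, False) (insert (Vtx w, True) T)"
  have rel: "p * \<phi> (config d L A) + q * \<phi> (config d L B) = 0" if "frustration_free d L lam \<phi>" for \<phi>
    using frustration_free_exchange[OF that vw L, of T] T n
    by (simp add: an_def cA cB p_def q_def mult.assoc)
  have "p * (\<psi> (config d L A) * G (config d L B)) = p * (\<psi> (config d L B) * G (config d L A))"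
    using rel[OF ff] rel[OF frustration_free_G] by algebra
  moreover have "p \<noteq> 0" by (simp add: p_def)
  ultimately show ?thesis using config_G by (simp add: field_simps)
qed

lemma frustration_free_imp_downs:
  assumes ff: "frustration_free d L lam \<psi>"
  obtains f where "\<psi> = (\<lambda>S. f (downs S) * G S)"
proof -
  define h where "h A = \<psi> (config d L A) / G (config d L A)" for A
  \<comment> \<open>Any representative will do, by \<open>card_inv\<close>. Values of
    \<open>k\<close> above \<open>L ^ d\<close> are never reached on the support of
    \<open>G\<close>.\<close>
  define f where "f k = h (SOME A. A \<subseteq> verts d L \<and> downs (config d L A) = k)" for k
  have card_inv: "h A = h B" if "A \<subseteq> verts d L" "B \<subseteq> verts d L" "card A = card B" for A B
    by (rule adjacent_swap_invariant_imp_card_invariant[OF _ that])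
      (use config_exchange[OF ff] in \<open>auto simp: h_def\<close>)
  have f: "f (downs (config d L A)) = h A" if A: "A \<subseteq> verts d L" for A
  proof -
    define B where "B = (SOME B. B \<subseteq> verts d L \<and> downs (config d L B) = downs (config d L A))"
    have B: "B \<subseteq> verts d L \<and> downs (config d L B) = downs (config d L A)"
      unfolding B_def by (rule someI[of _ A]) (use A in auto)
    \<comment> \<open>The bounds let the truncated difference in \<open>downs_config\<close> be
      inverted.\<close>
    have "card A \<le> L ^ d" "card B \<le> L ^ d"
      using A B card_mono[OF finite_verts] by (metis card_verts)+
    then have "card A = card B" using A B by (auto simp: downs_config)
    then show ?thesis using card_inv A B unfolding f_def B_def by metis
  qed
  \<comment> \<open>The difference is frustration-free and vanishes on every \<open>config\<close>,
    hence everywhere.\<close>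
  have "\<psi> S - f (downs S) * G S = 0" for S
    by (rule frustration_free_eq_0[OF frustration_free_diff[OF ff frustration_free_downs] L lam])
      (simp add: f h_def config_G)
  then show ?thesis by (intro that[of f]) auto
qed

end

section \<open>Total spin\<close>

text \<open>The action of a spin component on the states \<open>\<lambda>S. f (downs S) * G S\<close>, written as an operator
  on \<open>f\<close>; the factor \<open>k\<close> makes the value of \<open>f (k - 1)\<close> at \<open>k = 0\<close> irrelevant.\<close>

definition spin_action :: "nat \<Rightarrow> nat \<Rightarrow> (nat \<Rightarrow> complex) \<Rightarrow> nat \<Rightarrow> complex" where
  "spin_action n \<alpha> f k = 1/2 *
     ((of_nat n - of_nat k) * (pauli \<alpha> True True * f k + pauli \<alpha> True False * f (k + 1))
      + of_nat k * (pauli \<alpha> False True * f (k - 1) + pauli \<alpha> False False * f k))"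

text \<open>The ladder operators are S+ : \<open>(n - k) * f (k + 1)\<close> and S- :
  \<open>k * f (k - 1)\<close>, and S3 multiplies by \<open>n/2 - k\<close>. In S- S+ + S3^2 + S3
  the dependence on \<open>k\<close> cancels.\<close>

lemma spin_action_casimir:
  "(\<Sum>\<alpha>\<in>{1, 2, 3}. spin_action n \<alpha> (spin_action n \<alpha> f) k)
     = of_real ((real n / 2) * (real n / 2 + 1)) * f k"
\<comment> \<open>Two applications reach \<open>k - 2\<close>, so 0 and 1 are separated because of
  truncated subtraction.\<close>
proof (cases k)
  case 0
  then show ?thesis by (simp add: spin_action_def pauli_def field_simps)
next
  case (Suc j)
  then show ?thesis by (cases j) (simp_all add: spin_action_def pauli_def field_simps)
qed

context reference_state
begin

text \<open>By \<open>spin_G\<close> the annihilator of spin \<open>\<tau>\<close> acts on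
  \<open>G\<close> like that of spin \<open>\<sigma>\<close>; what remains on \<open>G\<close> is a
  number operator, and only the argument of \<open>f\<close> is shifted.\<close>

lemma cr_an_downs:
  assumes x: "x \<in> sites d L"
  shows "cr (x, \<sigma>) (an (x, \<tau>) (\<lambda>S. f (downs S) * G S)) S =
     (if (x, \<sigma>) \<in> S then f (downs S - (if \<sigma> then 0 else 1) + (if \<tau> then 0 else 1)) * G S else 0)"
proof (cases "(x, \<sigma>) \<in> S")
  case True
  define T where "T = S - {(x, \<sigma>)}"
  have T: "S = insert (x, \<sigma>) T" "(x, \<sigma>) \<notin> T" using True by (auto simp: T_def)
  show ?thesis
  proof (cases "S \<subseteq> modes d L")
    case sub: True
    then have fin: "finite T" unfolding T_def by (meson finite_Diff finite_modes finite_subset)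
    have "downs T = downs S - (if \<sigma> then 0 else 1)"
      using downs_insert[OF fin T(2)] T(1) by simp
    moreover have "an (x, \<tau>) G T = fsign (x, \<sigma>) T * G S"
      using spin_G[OF x, of \<tau> \<sigma>] T by (simp add: an_def)
    ultimately have "an (x, \<tau>) (\<lambda>S. f (downs S) * G S) T =
        f (downs S - (if \<sigma> then 0 else 1) + (if \<tau> then 0 else 1)) * (fsign (x, \<sigma>) T * G S)"
      using an_downs[OF fin, of "(x, \<tau>)" f] by simp
    then show ?thesis using True by (simp add: cr_def T_def[symmetric])
  next
    case False
    \<comment> \<open>Both sides are 0 here, since \<open>x\<close> is a lattice site and
      \<open>G\<close> is supported on lattice modes.\<close>
    then have "\<not> insert (x, \<tau>) T \<subseteq> modes d L"
      using x T by (auto simp: modes_def)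
    then show ?thesis using True False supp_G'
      by (simp add: cr_def an_def T_def[symmetric])
  qed
next
  case False
  then show ?thesis by (simp add: cr_def)
qed

text \<open>Summing the number operators over sites counts up and down electrons; on the support of
  \<open>G\<close> these are \<open>L ^ d - k\<close> and \<open>k\<close>.\<close>

lemma spin_tot_downs:
  "spin_tot d L \<alpha> (\<lambda>S. f (downs S) * G S) = (\<lambda>S. spin_action (L ^ d) \<alpha> f (downs S) * G S)"
proof
  fix S
  define k where "k = downs S"
  let ?c = "\<lambda>\<sigma> \<tau>. pauli \<alpha> \<sigma> \<tau> * f (k - (if \<sigma> then 0 else 1) + (if \<tau> then 0 else 1)) * G S"
  define C where "C = (\<lambda>\<sigma>. card {x \<in> sites d L. (x, \<sigma>) \<in> S})"
  have "spin_tot d L \<alpha> (\<lambda>S. f (downs S) * G S) S =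
     (\<Sum>x\<in>sites d L. 1/2 * (\<Sum>(\<sigma>, \<tau>)\<in>UNIV \<times> UNIV. pauli \<alpha> \<sigma> \<tau> *
        (if (x, \<sigma>) \<in> S then f (k - (if \<sigma> then 0 else 1) + (if \<tau> then 0 else 1)) * G S else 0)))"
    unfolding spin_tot_def opsum_def spin_site_def sc_def k_def
    by (intro sum.cong arg_cong2[of _ _ _ _ "(*)"]) (auto simp: cr_an_downs)
  also have "\<dots> = (\<Sum>x\<in>sites d L. (if (x, True) \<in> S then 1/2 * (?c True True + ?c True False) else 0)
        + (if (x, False) \<in> S then 1/2 * (?c False True + ?c False False) else 0))"
    by (intro sum.cong) (auto simp: UNIV_bool sum.cartesian_product[symmetric] algebra_simps)
  also have "\<dots> = of_nat (C True) * (1/2 * (?c True True + ?c True False))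
      + of_nat (C False) * (1/2 * (?c False True + ?c False False))"
    by (simp add: sum.distrib C_def flip: sum.inter_filter)
  also have "\<dots> = spin_action (L ^ d) \<alpha> f k * G S"
  proof (cases "G S = 0")
    case False
    then have S: "S \<subseteq> modes d L" "card S = L ^ d" using supp_G by auto
    have "C \<sigma> = card {m \<in> S. snd m = \<sigma>}" for \<sigma>
    proof -
      have "{m \<in> S. snd m = \<sigma>} = (\<lambda>x. (x, \<sigma>)) ` {x \<in> sites d L. (x, \<sigma>) \<in> S}"
        using S by (auto simp: modes_def)
      then show ?thesis by (simp add: C_def card_image inj_on_def)
    qed
    then have C: "C True = card {m \<in> S. snd m}" "C False = card {m \<in> S. \<not> snd m}" by auto
    have "finite S" using S finite_subset finite_modes by blast
    then have "card {m \<in> S. snd m} + card {m \<in> S. \<not> snd m} = card S"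
      by (subst card_Un_disjoint[symmetric]) (auto intro: arg_cong[of _ _ card])
    then have "C True + k = L ^ d" "C False = k" using C S by (auto simp: k_def downs_def)
    then have "of_nat (L ^ d) - of_nat k = complex_of_nat (C True)" "C False = k"
      by (metis add_diff_cancel_right' of_nat_add) fact
    \<comment> \<open>At \<open>k = 0\<close> the index \<open>k - 1 + 1\<close> is 1 rather than 0,
      but its coefficient is the vanishing number of down spins.\<close>
    then show ?thesis
      unfolding spin_action_def by (cases "k = 0") (simp_all add: algebra_simps del: of_nat_power)
  qed simp
  finally show "spin_tot d L \<alpha> (\<lambda>S. f (downs S) * G S) S = spin_action (L ^ d) \<alpha> f (downs S) * G S"
    by (simp add: k_def)
qed

lemma spin_sq_downs:
  "spin_sq d L (\<lambda>S. f (downs S) * G S) =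
     sc (of_real ((real (L ^ d) / 2) * (real (L ^ d) / 2 + 1))) (\<lambda>S. f (downs S) * G S)"
proof
  fix S
  have "spin_sq d L (\<lambda>S. f (downs S) * G S) S =
      (\<Sum>\<alpha>\<in>{1, 2, 3}. spin_action (L ^ d) \<alpha> (spin_action (L ^ d) \<alpha> f) (downs S)) * G S"
    unfolding spin_sq_def opsum_def spin_tot_downs sum_distrib_right ..
  also have "\<dots> = of_real ((real (L ^ d) / 2) * (real (L ^ d) / 2 + 1)) * (f (downs S) * G S)"
    unfolding spin_action_casimir by (simp only: mult.assoc)
  finally show "spin_sq d L (\<lambda>S. f (downs S) * G S) S = 
    sc (of_real ((real (L ^ d) / 2) * (real (L ^ d) / 2 + 1))) (\<lambda>S. f (downs S) * G S) S"
    by (simp only: sc_def)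
qed

end

section \<open>Positivity of the Hamiltonian\<close>

text \<open>The sum runs over lattice occupations only: the form is definite on
  \<open>fock d L\<close> and merely semidefinite on all states.\<close>

definition ip :: "nat \<Rightarrow> nat \<Rightarrow> state \<Rightarrow> state \<Rightarrow> complex" where
  "ip d L \<phi> \<psi> = (\<Sum>S\<in>Pow (modes d L). cnj (\<phi> S) * \<psi> S)"

lemma ip_cr:
  assumes "m \<in> modes d L"
  shows "ip d L \<phi> (cr m \<psi>) = ip d L (an m \<phi>) \<psi>"
proof -
  let ?M = "Pow (modes d L)"
  have fin: "finite ?M" by simp
  have "ip d L \<phi> (cr m \<psi>) = (\<Sum>S\<in>?M. if m \<in> S then cnj (\<phi> S) * (fsign m (S - {m}) * \<psi> (S - {m})) else 0)"
    unfolding ip_def by (intro sum.cong) (auto simp: cr_def)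
  also have "\<dots> = (\<Sum>S\<in>{S\<in>?M. m \<in> S}. cnj (\<phi> S) * (fsign m (S - {m}) * \<psi> (S - {m})))"
    by (rule sum.inter_filter[OF fin, symmetric])
  also have "\<dots> = (\<Sum>S\<in>{S\<in>?M. m \<notin> S}. cnj (fsign m S * \<phi> (insert m S)) * \<psi> S)"
    \<comment> \<open>Removing \<open>m\<close> matches the sets containing \<open>m\<close> with
      those that do not; this is why \<open>an\<close> is the adjoint of \<open>cr\<close>.\<close>
    by (rule sum.reindex_bij_witness[of _ "insert m" "\<lambda>S. S - {m}"])
      (use assms in \<open>auto simp: insert_absorb\<close>)
  also have "\<dots> = (\<Sum>S\<in>?M. if m \<notin> S then cnj (fsign m S * \<phi> (insert m S)) * \<psi> S else 0)"
    by (rule sum.inter_filter[OF fin])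
  also have "\<dots> = ip d L (an m \<phi>) \<psi>"
    unfolding ip_def by (intro sum.cong) (auto simp: an_def)
  finally show ?thesis .
qed

lemma ip_sc_right: "ip d L \<phi> (sc c \<psi>) = c * ip d L \<phi> \<psi>"
  and ip_addst_right: "ip d L \<phi> (addst \<psi> \<chi>) = ip d L \<phi> \<psi> + ip d L \<phi> \<chi>"
  and ip_sc_left: "ip d L (sc c \<phi>) \<psi> = cnj c * ip d L \<phi> \<psi>"
  and ip_addst_left: "ip d L (addst \<phi> \<chi>) \<psi> = ip d L \<phi> \<psi> + ip d L \<chi> \<psi>"
  by (simp_all add: ip_def sc_def addst_def sum_distrib_left sum.distrib algebra_simps)

lemma ip_opsum_right: "ip d L \<phi> (opsum A F) = (\<Sum>a\<in>A. ip d L \<phi> (F a))"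
  unfolding ip_def opsum_def sum_distrib_left by (rule sum.swap)

lemma cnj_ip: "cnj (ip d L \<phi> \<psi>) = ip d L \<psi> \<phi>"
  by (simp add: ip_def mult.commute)

lemma ip_self: "ip d L \<psi> \<psi> = of_real (\<Sum>S\<in>Pow (modes d L). (cmod (\<psi> S))\<^sup>2)"
  unfolding ip_def of_real_sum by (intro sum.cong refl) (metis complex_norm_square mult.commute)

lemma ip_bond_cr:
  assumes "b \<in> bonds d L" "L \<ge> 2"
  shows "ip d L \<phi> (bond_cr lam b \<sigma> \<psi>) = ip d L (bond_an lam b \<sigma> \<phi>) \<psi>"
  unfolding bond_cr_def bond_an_def
  using bond_sites[OF assms]
  by (simp add: ip_addst_right ip_addst_left ip_sc_left ip_sc_right ip_cr modes_def)

text \<open>This is the diagonal entry of the interaction in the occupation basis.\<close>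

definition repulsion :: "nat \<Rightarrow> nat \<Rightarrow> real \<Rightarrow> real \<Rightarrow> mode set \<Rightarrow> real" where
  "repulsion d L U U' S =
     U * real (card {x \<in> Vtx ` verts d L. (x, True) \<in> S \<and> (x, False) \<in> S})
     + U' * real (card {x \<in> mids d L. (x, True) \<in> S \<and> (x, False) \<in> S})"

lemma Hint_apply: "Hint d L U U' \<psi> S = of_real (repulsion d L U U' S) * \<psi> S"
proof -
  have *: "(\<Sum>x\<in>X. numop (x, True) (numop (x, False) \<psi>) S) =
      of_nat (card {x \<in> X. (x, True) \<in> S \<and> (x, False) \<in> S}) * \<psi> S" if "finite X" for X
  proof -
    have "(\<Sum>x\<in>X. numop (x, True) (numop (x, False) \<psi>) S) =
       (\<Sum>x\<in>X. if (x, True) \<in> S \<and> (x, False) \<in> S then \<psi> S else 0)"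
      by (intro sum.cong) (auto simp: numop_apply)
    then show ?thesis using that by (simp flip: sum.inter_filter)
  qed
  show ?thesis
    by (simp add: Hint_def addst_def sc_def opsum_def * mids_def repulsion_def algebra_simps)
qed

text \<open>Moving each \<open>bond_cr\<close> to the left argument exhibits the form as Hermitian
  and, for nonnegative couplings, positive.\<close>

lemma ip_Ham:
  assumes "L \<ge> 2"
  shows "ip d L \<phi> (Ham d L t lam U U' \<psi>) =
     of_real t * (\<Sum>\<sigma>\<in>UNIV. \<Sum>b\<in>bonds d L. ip d L (bond_an lam b \<sigma> \<phi>) (bond_an lam b \<sigma> \<psi>))
     + (\<Sum>S\<in>Pow (modes d L). of_real (repulsion d L U U' S) * (cnj (\<phi> S) * \<psi> S))"
proof -
  have "ip d L \<phi> (Hhop d L t lam \<psi>) =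
     of_real t * (\<Sum>\<sigma>\<in>UNIV. \<Sum>b\<in>bonds d L. ip d L (bond_an lam b \<sigma> \<phi>) (bond_an lam b \<sigma> \<psi>))"
    unfolding Hhop_def ip_opsum_right sum_distrib_left
    using assms by (intro sum.cong refl) (simp add: ip_sc_right ip_bond_cr)
  moreover have "ip d L \<phi> (Hint d L U U' \<psi>) =
      (\<Sum>S\<in>Pow (modes d L). of_real (repulsion d L U U' S) * (cnj (\<phi> S) * \<psi> S))"
    unfolding ip_def Hint_apply by (intro sum.cong refl) simp
  ultimately show ?thesis by (simp add: Ham_def ip_addst_right)
qed

lemma Ham_hermitian:
  assumes "L \<ge> 2"
  shows "ip d L \<phi> (Ham d L t lam U U' \<psi>) = cnj (ip d L \<psi> (Ham d L t lam U U' \<phi>))"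
  unfolding ip_Ham[OF assms] by (simp add: cnj_ip mult.commute)

lemma eigenstates_orthogonal:
  assumes "L \<ge> 2" "E \<noteq> E'"
    and "Ham d L t lam U U' \<phi> = sc (of_real E) \<phi>" "Ham d L t lam U U' \<psi> = sc (of_real E') \<psi>"
  shows "ip d L \<phi> \<psi> = 0"
proof -
  have "of_real E' * ip d L \<phi> \<psi> = of_real E * ip d L \<phi> \<psi>"
    using Ham_hermitian[OF assms(1), of d \<phi> t lam U U' \<psi>] assms(3,4)
    by (simp add: ip_sc_right cnj_ip)
  then show ?thesis using assms(2) by simp
qed

section \<open>Zero-energy states in a sector\<close>

lemma sector_iff:
  "\<psi> \<in> sector d L N \<longleftrightarrow> (\<forall>S. \<psi> S \<noteq> 0 \<longrightarrow> S \<subseteq> modes d L \<and> card S = N)"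
proof -
  have N: "Nop d L \<psi> S = of_nat (card (modes d L \<inter> S)) * \<psi> S" for S
  proof -
    have "Nop d L \<psi> S = (\<Sum>m\<in>modes d L. if m \<in> S then \<psi> S else 0)"
      by (simp add: Nop_def opsum_def numop_apply)
    then show ?thesis by (simp add: Int_def flip: sum.inter_filter)
  qed
  show ?thesis
  proof (cases "\<psi> \<in> fock d L")
    case True
    have "Nop d L \<psi> = sc (of_nat N) \<psi> \<longleftrightarrow> (\<forall>S. \<psi> S \<noteq> 0 \<longrightarrow> card (modes d L \<inter> S) = N)"
      by (auto simp: fun_eq_iff N sc_def)
    then show ?thesis using True unfolding sector_def fock_def
      by (auto simp: Int_absorb1)
  qed (auto simp: sector_def fock_def)
qed

lemma energy_identity:
  assumes "L \<ge> 2" "Ham d L t lam U U' \<psi> = sc (of_real E) \<psi>"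
  shows "E * (\<Sum>S\<in>Pow (modes d L). (cmod (\<psi> S))\<^sup>2) =
     t * (\<Sum>\<sigma>\<in>UNIV. \<Sum>b\<in>bonds d L. \<Sum>S\<in>Pow (modes d L). (cmod (bond_an lam b \<sigma> \<psi> S))\<^sup>2)
     + (\<Sum>S\<in>Pow (modes d L). repulsion d L U U' S * (cmod (\<psi> S))\<^sup>2)"
proof -
  have "complex_of_real (E * (\<Sum>S\<in>Pow (modes d L). (cmod (\<psi> S))\<^sup>2)) = ip d L \<psi> (Ham d L t lam U U' \<psi>)"
    by (simp only: assms(2) ip_sc_right ip_self of_real_mult)
  also have "\<dots> = of_real (t * (\<Sum>\<sigma>\<in>UNIV. \<Sum>b\<in>bonds d L. \<Sum>S\<in>Pow (modes d L). (cmod (bond_an lam b \<sigma> \<psi> S))\<^sup>2)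
     + (\<Sum>S\<in>Pow (modes d L). repulsion d L U U' S * (cmod (\<psi> S))\<^sup>2))"
    unfolding ip_Ham[OF assms(1)] ip_self of_real_add of_real_mult of_real_sum
    by (intro arg_cong2[of _ _ _ _ "(+)"] refl sum.cong) (metis complex_norm_square mult.commute of_real_power)
  finally show ?thesis by (simp only: of_real_eq_iff)
qed

lemma repulsion_nonneg: "U \<ge> 0 \<Longrightarrow> U' \<ge> 0 \<Longrightarrow> repulsion d L U U' S \<ge> 0"
  by (simp add: repulsion_def)

lemma repulsion_pos:
  assumes "U > 0" "U' > 0" "x \<in> sites d L" "(x, True) \<in> S" "(x, False) \<in> S"
  shows "repulsion d L U U' S > 0"
proof (cases "x \<in> mids d L")
  case True
  then have "card {x \<in> mids d L. (x, True) \<in> S \<and> (x, False) \<in> S} > 0"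
    using assms by (auto simp: card_gt_0_iff mids_def)
  then show ?thesis using assms by (simp add: repulsion_def add_nonneg_pos)
next
  case False
  then have "card {x \<in> Vtx ` verts d L. (x, True) \<in> S \<and> (x, False) \<in> S} > 0"
    using assms by (auto simp: card_gt_0_iff sites_def)
  then show ?thesis using assms by (simp add: repulsion_def add_pos_nonneg)
qed

lemma energy_nonneg:
  assumes "L \<ge> 2" "t \<ge> 0" "U \<ge> 0" "U' \<ge> 0" "E \<in> energies d L t lam U U' N"
  shows "E \<ge> 0"
proof -
  obtain \<psi> where \<psi>: "\<psi> \<in> sector d L N" "\<psi> \<noteq> (\<lambda>_. 0)" "Ham d L t lam U U' \<psi> = sc (of_real E) \<psi>"
    using assms(5) by (auto simp: energies_def)
  from \<psi>(2) obtain S where S: "\<psi> S \<noteq> 0" by auto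
  then have "S \<in> Pow (modes d L)" using \<psi>(1) by (auto simp: sector_iff)
  then have "(\<Sum>S\<in>Pow (modes d L). (cmod (\<psi> S))\<^sup>2) > 0"
    using S by (intro sum_pos2[of _ S]) auto
  moreover have "E * (\<Sum>S\<in>Pow (modes d L). (cmod (\<psi> S))\<^sup>2) \<ge> 0"
    unfolding energy_identity[OF assms(1) \<psi>(3)]
    using assms by (intro add_nonneg_nonneg mult_nonneg_nonneg sum_nonneg repulsion_nonneg) auto
  ultimately show ?thesis by (simp add: zero_le_mult_iff)
qed

text \<open>At energy 0 the nonnegative terms of \<open>energy_identity\<close> must vanish one by
  one. Conversely, both parts of the Hamiltonian kill a frustration-free state.\<close>

lemma zero_energy_iff_frustration_free:
  assumes "L \<ge> 2" "t > 0" "U > 0" "U' > 0"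
  shows "\<psi> \<in> sector d L (L ^ d) \<and> Ham d L t lam U U' \<psi> = sc 0 \<psi> \<longleftrightarrow> frustration_free d L lam \<psi>"
proof
  assume ff: "frustration_free d L lam \<psi>"
  have "\<psi> \<in> sector d L (L ^ d)" using ff by (simp add: sector_iff frustration_free_def)
  moreover have "Ham d L t lam U U' \<psi> S = sc 0 \<psi> S" for S
  proof -
    have "bond_an lam b \<sigma> \<psi> = (\<lambda>S. 0)" if "b \<in> bonds d L" for b \<sigma>
      using ff that by (auto simp: frustration_free_def)
    moreover have "bond_cr lam b \<sigma> (\<lambda>S. 0) S = 0" for b \<sigma>
      by (simp add: bond_cr_def addst_def sc_def cr_def)
    ultimately have "Hhop d L t lam \<psi> S = 0" by (simp add: Hhop_def opsum_def sc_def)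
    moreover have "repulsion d L U U' S = 0" if "\<psi> S \<noteq> 0"
    proof -
      have "{x \<in> sites d L. (x, True) \<in> S \<and> (x, False) \<in> S} = {}"
        using ff that by (auto simp: frustration_free_def)
      then have "{x \<in> Vtx ` verts d L. (x, True) \<in> S \<and> (x, False) \<in> S} = {}"
        "{x \<in> mids d L. (x, True) \<in> S \<and> (x, False) \<in> S} = {}"
        by (auto simp: sites_def)
      then show ?thesis by (simp only: repulsion_def) simp
    qed
    ultimately show ?thesis by (auto simp: Ham_def addst_def Hint_apply sc_def)
  qed
  ultimately show "\<psi> \<in> sector d L (L ^ d) \<and> Ham d L t lam U U' \<psi> = sc 0 \<psi>" by auto
next
  assume "\<psi> \<in> sector d L (L ^ d) \<and> Ham d L t lam U U' \<psi> = sc 0 \<psi>"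
  then have sec: "\<And>S. \<psi> S \<noteq> 0 \<Longrightarrow> S \<subseteq> modes d L \<and> card S = L ^ d"
    and H: "Ham d L t lam U U' \<psi> = sc (of_real 0) \<psi>" by (auto simp: sector_iff)
  let ?hop = "\<Sum>\<sigma>\<in>UNIV. \<Sum>b\<in>bonds d L. \<Sum>S\<in>Pow (modes d L). (cmod (bond_an lam b \<sigma> \<psi> S))\<^sup>2"
  let ?int = "\<Sum>S\<in>Pow (modes d L). repulsion d L U U' S * (cmod (\<psi> S))\<^sup>2"
  have rep: "repulsion d L U U' S \<ge> 0" for S using assms by (intro repulsion_nonneg) auto
  have "t * ?hop + ?int = 0" using energy_identity[OF assms(1) H] by simp
  moreover have "t * ?hop \<ge> 0" "?int \<ge> 0"
    using assms rep by (auto intro!: mult_nonneg_nonneg sum_nonneg)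
  ultimately have "?hop = 0" "?int = 0" using assms(2) by (auto simp: add_nonneg_eq_0_iff)
  \<comment> \<open>The identity sees lattice occupations only; elsewhere the support of
    \<open>\<psi>\<close> gives the claim.\<close>
  have outside: "bond_an lam b \<sigma> \<psi> S = 0" if "S \<notin> Pow (modes d L)" for b \<sigma> S
  proof -
    have "\<psi> (insert m S) = 0" for m using sec[of "insert m S"] that by auto
    then show ?thesis by (simp add: bond_an_apply an_def)
  qed
  have "bond_an lam b \<sigma> \<psi> S = 0" if "b \<in> bonds d L" "S \<in> Pow (modes d L)" for b \<sigma> S
  proof -
    have "(\<Sum>b\<in>bonds d L. \<Sum>S\<in>Pow (modes d L). (cmod (bond_an lam b \<sigma> \<psi> S))\<^sup>2) = 0"
      using \<open>?hop = 0\<close> by (subst (asm) sum_nonneg_eq_0_iff) (auto intro!: sum_nonneg)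
    then have "(\<Sum>S\<in>Pow (modes d L). (cmod (bond_an lam b \<sigma> \<psi> S))\<^sup>2) = 0"
      using that by (subst (asm) sum_nonneg_eq_0_iff) (auto intro!: sum_nonneg)
    then have "(cmod (bond_an lam b \<sigma> \<psi> S))\<^sup>2 = 0"
      using that(2) by (subst (asm) sum_nonneg_eq_0_iff) auto
    then show ?thesis by simp
  qed
  then have "bond_an lam b \<sigma> \<psi> S = 0" if "b \<in> bonds d L" for b \<sigma> S
    using that outside by (cases "S \<in> Pow (modes d L)") auto
  moreover have "\<psi> S = 0" if "x \<in> sites d L" "(x, True) \<in> S" "(x, False) \<in> S" for x S
  proof (rule ccontr)
    assume nz: "\<psi> S \<noteq> 0"
    then have "S \<in> Pow (modes d L)" using sec by auto
    then have "repulsion d L U U' S * (cmod (\<psi> S))\<^sup>2 = 0"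
      using \<open>?int = 0\<close> rep by (subst (asm) sum_nonneg_eq_0_iff) auto
    then show False using nz repulsion_pos[OF assms(3,4) that] by simp
  qed
  ultimately show "frustration_free d L lam \<psi>" using sec
    unfolding frustration_free_def by (intro conjI) blast+
qed

section \<open>The ground state space\<close>

interpretation state_space: vector_space "\<lambda>(c::complex) (\<psi>::state) S. c * \<psi> S"
  by unfold_locales (auto simp: algebra_simps)

lemma sum_state_apply: "(\<Sum>a\<in>A. F a) S = (\<Sum>a\<in>A. (F a :: state) S)"
  by (induction A rule: infinite_finite_induct) auto

lemma finite_dimensional_fock:
  assumes "state_space.independent B" "B \<subseteq> fock d L"
  shows "finite B"
proof -
  define e :: "mode set \<Rightarrow> state" where "e = (\<lambda>T S. if S = T then 1 else 0)"
  have "fock d L \<subseteq> state_space.span (e ` Pow (modes d L))"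
  proof
    fix \<psi> assume \<psi>: "\<psi> \<in> fock d L"
    have "\<psi> = (\<Sum>T\<in>Pow (modes d L). (\<lambda>S. \<psi> T * e T S))"
    proof
      fix S
      have "(\<Sum>T\<in>Pow (modes d L). \<psi> T * e T S) = (\<Sum>T\<in>Pow (modes d L). if S = T then \<psi> T else 0)"
        by (intro sum.cong) (auto simp: e_def)
      also have "\<dots> = \<psi> S" using \<psi> by (auto simp: fock_def)
      finally show "\<psi> S = (\<Sum>T\<in>Pow (modes d L). (\<lambda>S. \<psi> T * e T S)) S"
        by (simp add: sum_state_apply)
    qed
    also have "\<dots> \<in> state_space.span (e ` Pow (modes d L))"
      by (intro state_space.span_sum state_space.span_scale state_space.span_base) auto
    finally show "\<psi> \<in> state_space.span (e ` Pow (modes d L))" .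
  qed
  then show ?thesis
    using state_space.independent_span_bound[of "e ` Pow (modes d L)" B] assms by auto
qed

lemma independent_orthogonal:
  assumes "\<And>\<phi> \<psi>. \<phi> \<in> B \<Longrightarrow> \<psi> \<in> B \<Longrightarrow> \<phi> \<noteq> \<psi> \<Longrightarrow> ip d L \<phi> \<psi> = 0"
    and "\<And>\<psi>. \<psi> \<in> B \<Longrightarrow> ip d L \<psi> \<psi> \<noteq> 0"
  shows "state_space.independent B"
proof
  assume "state_space.dependent B"
  then obtain T u \<phi> where T: "finite T" "T \<subseteq> B" "(\<Sum>\<psi>\<in>T. (\<lambda>S. u \<psi> * \<psi> S)) = 0" "\<phi> \<in> T" "u \<phi> \<noteq> 0"
    unfolding state_space.dependent_explicit by blast
  have "0 = ip d L \<phi> (\<lambda>S. \<Sum>\<psi>\<in>T. u \<psi> * \<psi> S)"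
    using T(3) by (simp add: ip_def fun_eq_iff sum_state_apply)
  also have "\<dots> = (\<Sum>\<psi>\<in>T. u \<psi> * ip d L \<phi> \<psi>)"
    using ip_opsum_right[of d L \<phi> T "\<lambda>\<psi>. sc (u \<psi>) \<psi>"] by (simp only: opsum_def ip_sc_right) (simp add: sc_def)
  also have "\<dots> = (\<Sum>\<psi>\<in>T. if \<psi> = \<phi> then u \<phi> * ip d L \<phi> \<phi> else 0)"
    by (intro sum.cong refl) (use assms(1) T in auto)
  also have "\<dots> = u \<phi> * ip d L \<phi> \<phi>" using T by simp
  finally show False using assms(2) T by auto
qed

text \<open>\<open>Min\<close> is meaningful only on a finite set. Eigenvectors for distinct
  energies are orthogonal, hence independent, and the Fock space has finite dimension.\<close>

lemma finite_energies:
  assumes "L \<ge> 2"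
  shows "finite (energies d L t lam U U' N)"
proof -
  let ?E = "energies d L t lam U U' N"
  have "\<forall>E\<in>?E. \<exists>\<psi>. \<psi> \<in> sector d L N \<and> \<psi> \<noteq> (\<lambda>_. 0) \<and> Ham d L t lam U U' \<psi> = sc (of_real E) \<psi>"
    by (auto simp: energies_def)
  then obtain w where w: "\<And>E. E \<in> ?E \<Longrightarrow> w E \<in> sector d L N"
    "\<And>E. E \<in> ?E \<Longrightarrow> w E \<noteq> (\<lambda>_. 0)"
    "\<And>E. E \<in> ?E \<Longrightarrow> Ham d L t lam U U' (w E) = sc (of_real E) (w E)"
    by metis
  \<comment> \<open>Membership in the sector excludes amplitudes that \<open>ip\<close> cannot
    see.\<close>
  have nz: "ip d L (w E) (w E) \<noteq> 0" if "E \<in> ?E" for E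
  proof
    assume "ip d L (w E) (w E) = 0"
    then have "(\<Sum>S\<in>Pow (modes d L). (cmod (w E S))\<^sup>2) = 0"
      unfolding ip_self of_real_eq_0_iff .
    then have "w E S = 0" if "S \<subseteq> modes d L" for S
      using that by (subst (asm) sum_nonneg_eq_0_iff) auto
    moreover have "w E S = 0" if "\<not> S \<subseteq> modes d L" for S
      using w(1)[OF \<open>E \<in> ?E\<close>] that unfolding sector_iff by blast
    ultimately have "w E = (\<lambda>_. 0)" by blast
    then show False using w(2)[OF that] by contradiction
  qed
  have orth: "ip d L (w E) (w E') = 0" if "E \<in> ?E" "E' \<in> ?E" "E \<noteq> E'" for E E'
    by (rule eigenstates_orthogonal[OF assms that(3) w(3)[OF that(1)] w(3)[OF that(2)]])
  have "inj_on w ?E" using nz orth by (metis inj_onI)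
  moreover have "state_space.independent (w ` ?E)"
    by (rule independent_orthogonal) (use nz orth in auto)
  then have "finite (w ` ?E)"
    by (rule finite_dimensional_fock) (use w(1) in \<open>auto simp: sector_def\<close>)
  ultimately show ?thesis using finite_imageD by blast
qed

section \<open>Identification of the ground space and its dimension\<close>

lemma downs_le_card: "finite S \<Longrightarrow> downs S \<le> card S"
  by (auto simp: downs_def intro: card_mono)

text \<open>\<open>G\<close> attains 0 and no energy is negative, so the ground states are the
  frustration-free ones.\<close>

lemma (in reference_state) ground_space_eq:
  assumes "t > 0" "U > 0" "U' > 0"
  shows "ground_space d L t lam U U' (L ^ d) = {\<lambda>S. f (downs S) * G S | f. True}"
proof -
  let ?E = "energies d L t lam U U' (L ^ d)"
  note zero = zero_energy_iff_frustration_free[OF L assms, where d = d and lam = lam]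
  have "G \<noteq> (\<lambda>_. 0)" using config_G[of "{}"] by auto
  then have "0 \<in> ?E" using zero[of G] frustration_free_G by (auto simp: energies_def)
  then have "ground_energy d L t lam U U' (L ^ d) = 0"
    unfolding ground_energy_def
    using energy_nonneg[OF L, of t U U' _ d lam] assms finite_energies[OF L]
    by (intro Min_eqI) auto
  then have "ground_space d L t lam U U' (L ^ d) = {\<psi>. frustration_free d L lam \<psi>}"
    unfolding ground_space_def using zero by auto
  also have "\<dots> = {\<lambda>S. f (downs S) * G S | f. True}"
    by (auto elim!: frustration_free_imp_downs intro: frustration_free_downs)
  finally show ?thesis .
qed

lemma (in reference_state) cdim_downs: "cdim {\<lambda>S. f (downs S) * G S | f. True} = L ^ d + 1"
proof -
  \<comment> \<open>The components of \<open>G\<close> with a fixed number of down spins, from 0 to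
    \<open>L ^ d\<close>, form the basis.\<close>
  define e where "e = (\<lambda>k::nat. \<lambda>S. (if downs S = k then 1 else 0) * G S)"
  have "\<exists>S. downs S = k \<and> G S \<noteq> 0" if "k \<le> L ^ d" for k
  proof -
    obtain A where "A \<subseteq> verts d L" "card A = L ^ d - k"
      using obtain_subset_with_card_n[of "L ^ d - k" "verts d L"] by (auto simp: card_verts)
    then show ?thesis using that config_G by (intro exI[of _ "config d L A"]) (auto simp: downs_config)
  qed
  \<comment> \<open>Evaluation at \<open>s k\<close> detects \<open>e k\<close> alone; it yields
    both injectivity and independence.\<close>
  then obtain s where s: "\<And>k. k \<le> L ^ d \<Longrightarrow> downs (s k) = k" "\<And>k. k \<le> L ^ d \<Longrightarrow> G (s k) \<noteq> 0"
    by metis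
  have es: "e j (s k) = 0 \<longleftrightarrow> j \<noteq> k" if "k \<le> L ^ d" for j k
    using s[OF that] by (auto simp: e_def)
  have inj: "inj_on e {..L ^ d}"
    by (rule inj_onI) (metis es atMost_iff)
  have "state_space.dim {\<lambda>S. f (downs S) * G S | f. True} = L ^ d + 1"
  proof (rule state_space.dim_unique)
    show "e ` {..L ^ d} \<subseteq> {\<lambda>S. f (downs S) * G S | f. True}"
      unfolding e_def by (auto intro: exI[of _ "\<lambda>j. if j = k then 1 else 0" for k])
    show "card (e ` {..L ^ d}) = L ^ d + 1" by (simp add: card_image[OF inj])
    show "{\<lambda>S. f (downs S) * G S | f. True} \<subseteq> state_space.span (e ` {..L ^ d})"
    proof clarify
      fix f
      have "(\<lambda>S. f (downs S) * G S) = (\<Sum>k\<in>{..L ^ d}. (\<lambda>S. f k * e k S))"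
      proof
        fix S
        have "(\<Sum>k\<le>L ^ d. f k * e k S) = (\<Sum>k\<le>L ^ d. if downs S = k then f k * G S else 0)"
          by (intro sum.cong) (auto simp: e_def)
        also have "\<dots> = f (downs S) * G S"
        proof (cases "G S = 0")
          case False
          then have "S \<subseteq> modes d L" "card S = L ^ d" using supp_G by auto
          then have "downs S \<le> L ^ d" using downs_le_card finite_subset finite_modes by metis
          then show ?thesis by simp
        qed simp
        finally show "f (downs S) * G S = (\<Sum>k\<in>{..L ^ d}. (\<lambda>S. f k * e k S)) S"
          by (simp add: sum_state_apply)
      qed
      also have "\<dots> \<in> state_space.span (e ` {..L ^ d})"
        by (intro state_space.span_sum state_space.span_scale state_space.span_base) auto
      finally show "(\<lambda>S. f (downs S) * G S) \<in> state_space.span (e ` {..L ^ d})" .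
    qed
    show "state_space.independent (e ` {..L ^ d})"
    proof
      assume "state_space.dependent (e ` {..L ^ d})"
      then obtain T u \<phi> where T: "finite T" "T \<subseteq> e ` {..L ^ d}"
        "(\<Sum>\<psi>\<in>T. (\<lambda>S. u \<psi> * \<psi> S)) = 0" "\<phi> \<in> T" "u \<phi> \<noteq> 0"
        unfolding state_space.dependent_explicit by blast
      then obtain k where k: "\<phi> = e k" "k \<le> L ^ d" by auto
      have "0 = (\<Sum>\<psi>\<in>T. u \<psi> * \<psi> (s k))"
        using T(3) by (simp add: fun_eq_iff sum_state_apply)
      also have "\<dots> = (\<Sum>\<psi>\<in>T. if \<psi> = \<phi> then u \<phi> * \<phi> (s k) else 0)"
        by (intro sum.cong refl) (use T(2) k es in auto)
      also have "\<dots> = u \<phi> * \<phi> (s k)" using T by simp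
      finally show False using T k es by auto
    qed
  qed
  then show ?thesis by (simp add: cdim_def)
qed

theorem theorem2p3:
  fixes d L :: nat and t lam U U' :: real
  assumes "d \<ge> 1" and "L \<ge> 4" and "even L"
    and "t > 0" and "lam > 0" and "U > 0" and "U' > 0"
  shows "(\<forall>\<psi> \<in> ground_space d L t lam U U' (L ^ d).
            spin_sq d L \<psi> = sc (of_real ((real (L ^ d) / 2) * (real (L ^ d) / 2 + 1))) \<psi>)
       \<and> cdim (ground_space d L t lam U U' (L ^ d)) = L ^ d + 1"
proof -
  obtain G where "reference_state d L lam G"
    by (rule reference_state_exists[of L lam]) (use assms in auto)
  then interpret reference_state d L lam G .
  show ?thesis
    unfolding ground_space_eq[OF assms(4,6,7)] using cdim_downs spin_sq_downs by auto
qed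

end
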